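(* Let $\lambda\in(0,\lambda_{\max}]$ and positive integers $M,K$ with $M\ge K+1$ be given, and consider the energy efficiency (EE) optimization problem described in the context with these values fixed. Define $$\rho^*=\frac{\frac{2^\gamma-1}{1-2^\gamma\epsilon^2}\,\frac{\omega\sigma^2\,\Gamma(\alpha/2+1)}{(\pi\lambda)^{\alpha/2}}}{M-K-\frac{2^\gamma-1}{1-2^\gamma\epsilon^2}\,\frac{2K}{\alpha-2}}.$$ If the problem is feasible, then the constraint $\widetilde{\mathrm{SE}}=\gamma$ is satisfied by $\rho=\rho^*$. The problem is infeasible whenever $\rho^*$ is negative (i.e., when the denominator in the definition of $\rho^*$ is negative).
   Context: Fixed parameters: $\alpha>2$, $\omega>0$, $\sigma^2>0$, $0\le\epsilon<1$, $\eta\in(0,1]$, positive constants $\mathcal{A},\mathcal{C}_0,\mathcal{C}_1,\mathcal{D}_0,\mathcal{D}_1$, a maximal access point density $\lambda_{\max}\in(0,\infty)$, and a target spectral efficiency $\gamma$ with $0\le\gamma<-2\log_2(\epsilon)$ (upper bound $+\infty$ if $\epsilon=0$). Spectral efficiency bound: $$\widetilde{\mathrm{SE}}=\log_2\left(1+\frac{(1-\epsilon^2)(M-K)}{\frac{2K}{\alpha-2}+\epsilon^2(M-K)+\frac{\Gamma(\alpha/2+1)}{(\pi\lambda)^{\alpha/2}}\frac{\omega\sigma^2}{\rho}}\right),$$ with the convention $\widetilde{\mathrm{SE}}=0$ when $\rho=0$. EE metric: $$\widetilde{\mathrm{EE}}(\rho,\lambda,M,K)=\frac{K\,\widetilde{\mathrm{SE}}}{\frac{K\rho}{\eta}+\mathcal{C}_0+\mathcal{C}_1K+\mathcal{D}_0M+\mathcal{D}_1MK+\mathcal{A}K\,\widetilde{\mathrm{SE}}}.$$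 EE optimization problem: maximize $\widetilde{\mathrm{EE}}(\rho,\lambda,M,K)$ over $\rho\ge0$, $\lambda\le\lambda_{\max}$, and positive integers $M,K$, subject to $\widetilde{\mathrm{SE}}=\gamma$ and $M\ge K+1$. For fixed $(\lambda,M,K)$ with $M\ge K+1$ it is feasible if there exists $\rho\ge0$ with $\widetilde{\mathrm{SE}}=\gamma$. *)

theory Defs
  imports "HOL-Analysis.Analysis"
begin

text \<open>Coefficient of \<open>1 / \<rho>\<close> in the noise term of the spectral efficiency bound.\<close>

definition noise_coeff :: "real \<Rightarrow> real \<Rightarrow> real \<Rightarrow> real \<Rightarrow> real" where
  "noise_coeff \<alpha> \<omega> \<sigma> lam =
     Gamma (\<alpha> / 2 + 1) / (pi * lam) powr (\<alpha> / 2) * (\<omega> * \<sigma>\<^sup>2)"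

definition SE :: "real \<Rightarrow> real \<Rightarrow> real \<Rightarrow> real \<Rightarrow> real \<Rightarrow> real \<Rightarrow> nat \<Rightarrow> nat \<Rightarrow> real" where
  "SE \<alpha> \<omega> \<sigma> \<epsilon> \<rho> lam M K =
     (if \<rho> = 0 then 0
      else log 2 (1 + (1 - \<epsilon>\<^sup>2) * (real M - real K) /
                    (2 * real K / (\<alpha> - 2) + \<epsilon>\<^sup>2 * (real M - real K)
                     + noise_coeff \<alpha> \<omega> \<sigma> lam / \<rho>)))"

definition EE :: "real \<Rightarrow> real \<Rightarrow> real \<Rightarrow> real \<Rightarrow> real \<Rightarrow> real \<Rightarrow> real \<Rightarrow> real \<Rightarrow> real \<Rightarrow> real \<Rightarrow>
    real \<Rightarrow> real \<Rightarrow> nat \<Rightarrow> nat \<Rightarrow> real" where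
  "EE \<alpha> \<omega> \<sigma> \<epsilon> \<eta> A C0 C1 D0 D1 \<rho> lam M K =
     real K * SE \<alpha> \<omega> \<sigma> \<epsilon> \<rho> lam M K /
     (real K * \<rho> / \<eta> + C0 + C1 * real K + D0 * real M + D1 * real M * real K
      + A * real K * SE \<alpha> \<omega> \<sigma> \<epsilon> \<rho> lam M K)"

record 'a max_problem =
  objective :: "'a \<Rightarrow> real"
  feasible_set :: "'a set"

text \<open>The density \<open>lam\<close> is taken to be positive, which the bound tacitly requires.\<close>

definition EE_problem :: "real \<Rightarrow> real \<Rightarrow> real \<Rightarrow> real \<Rightarrow> real \<Rightarrow> real \<Rightarrow> real \<Rightarrow> real \<Rightarrow> real \<Rightarrow> real \<Rightarrow>
    real \<Rightarrow> real \<Rightarrow> (real \<times> real \<times> nat \<times> nat) max_problem" where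
  "EE_problem \<alpha> \<omega> \<sigma> \<epsilon> \<eta> A C0 C1 D0 D1 lam_max \<gamma> =
     \<lparr> objective = (\<lambda>(\<rho>, lam, M, K). EE \<alpha> \<omega> \<sigma> \<epsilon> \<eta> A C0 C1 D0 D1 \<rho> lam M K),
       feasible_set = {(\<rho>, lam, M, K).
         \<rho> \<ge> 0 \<and> 0 < lam \<and> lam \<le> lam_max \<and> 0 < M \<and> 0 < K \<and>
         SE \<alpha> \<omega> \<sigma> \<epsilon> \<rho> lam M K = \<gamma> \<and> M \<ge> K + 1} \<rparr>"

definition feasible_at ::
    "(real \<times> real \<times> nat \<times> nat) max_problem \<Rightarrow> real \<Rightarrow> nat \<Rightarrow> nat \<Rightarrow> bool" where
  "feasible_at P lam M K \<longleftrightarrow> (\<exists>\<rho>. (\<rho>, lam, M, K) \<in> feasible_set P)"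

definition rho_star_denom :: "real \<Rightarrow> real \<Rightarrow> real \<Rightarrow> nat \<Rightarrow> nat \<Rightarrow> real" where
  "rho_star_denom \<alpha> \<epsilon> \<gamma> M K =
     real M - real K
     - (2 powr \<gamma> - 1) / (1 - 2 powr \<gamma> * \<epsilon>\<^sup>2) * (2 * real K / (\<alpha> - 2))"

definition rho_star ::
    "real \<Rightarrow> real \<Rightarrow> real \<Rightarrow> real \<Rightarrow> real \<Rightarrow> real \<Rightarrow> nat \<Rightarrow> nat \<Rightarrow> real" where
  "rho_star \<alpha> \<omega> \<sigma> \<epsilon> \<gamma> lam M K =
     (2 powr \<gamma> - 1) / (1 - 2 powr \<gamma> * \<epsilon>\<^sup>2)
       * (\<omega> * \<sigma>\<^sup>2 * Gamma (\<alpha> / 2 + 1) / (pi * lam) powr (\<alpha> / 2))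
     / rho_star_denom \<alpha> \<epsilon> \<gamma> M K"

end

theory Submission
  imports Defs
begin

text \<open>
  Multiplying out, the rate constraint becomes the linear equation
  \<open>\<rho> * rho_star_denom = t * noise_coeff\<close> in \<open>\<rho>\<close>, where \<open>t = (2 powr \<gamma> - 1) / (1 - 2 powr \<gamma> * \<epsilon>\<^sup>2)\<close>.
  Its right-hand side is nonnegative and vanishes only for \<open>\<gamma> = 0\<close>, in which case the
  coefficient of \<open>\<rho>\<close> is \<open>M - K > 0\<close>; hence a nonnegative solution forces a positive coefficient.
\<close>

lemma noise_coeff_pos:
  assumes "\<alpha> > 2" "\<omega> > 0" "\<sigma>\<^sup>2 > 0" "lam > 0"
  shows "noise_coeff \<alpha> \<omega> \<sigma> lam > 0"
  unfolding noise_coeff_def using assms by (intro mult_pos_pos divide_pos_pos Gamma_real_pos) auto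

lemma rho_star_eq:
  "rho_star \<alpha> \<omega> \<sigma> \<epsilon> \<gamma> lam M K =
     (2 powr \<gamma> - 1) / (1 - 2 powr \<gamma> * \<epsilon>\<^sup>2) * noise_coeff \<alpha> \<omega> \<sigma> lam / rho_star_denom \<alpha> \<epsilon> \<gamma> M K"
  by (simp add: rho_star_def noise_coeff_def mult_ac)

text \<open>For \<open>\<epsilon> > 0\<close>, writing the square as
  \<open>2 powr (2 * log 2 \<epsilon>)\<close> turns the bound on \<open>\<gamma>\<close> into
  negativity of the total exponent. This keeps the denominator of \<open>t\<close> positive.\<close>

lemma powr_mult_square_less_1:
  fixes \<epsilon> \<gamma> :: real
  assumes "0 \<le> \<epsilon>" "\<epsilon> > 0 \<Longrightarrow> \<gamma> < - 2 * log 2 \<epsilon>"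
  shows "2 powr \<gamma> * \<epsilon>\<^sup>2 < 1"
proof (cases "\<epsilon> = 0")
  case False
  then have pos: "\<epsilon> > 0" using assms by simp
  have "2 powr \<gamma> * \<epsilon>\<^sup>2 = 2 powr (\<gamma> + 2 * log 2 \<epsilon>)"
    using pos by (simp only: powr_add mult_2 power2_eq_square) simp
  also have "\<dots> < 2 powr 0"
    using assms(2)[OF pos] by (intro powr_less_mono) auto
  finally show ?thesis by simp
qed simp

lemma SE_eq_iff:
  assumes "\<alpha> > 2" "\<omega> > 0" "\<sigma>\<^sup>2 > 0" "\<epsilon>\<^sup>2 < 1" "2 powr \<gamma> * \<epsilon>\<^sup>2 < 1" "lam > 0" "K < M" "\<rho> \<ge> 0"
  shows "SE \<alpha> \<omega> \<sigma> \<epsilon> \<rho> lam M K = \<gamma> \<longleftrightarrow>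
    \<rho> * rho_star_denom \<alpha> \<epsilon> \<gamma> M K
      = (2 powr \<gamma> - 1) / (1 - 2 powr \<gamma> * \<epsilon>\<^sup>2) * noise_coeff \<alpha> \<omega> \<sigma> lam"
proof -
  define b where "b = noise_coeff \<alpha> \<omega> \<sigma> lam"
  define c where "c = 2 * real K / (\<alpha> - 2)"
  define m where "m = real M - real K"
  define e where "e = \<epsilon>\<^sup>2"
  define G where "G = 2 powr \<gamma>"
  have b: "b > 0" unfolding b_def using assms by (intro noise_coeff_pos)
  have c: "c \<ge> 0" using assms by (simp add: c_def)
  have m: "m > 0" using assms by (simp add: m_def)
  have e: "e \<ge> 0" "e < 1" and Ge: "G * e < 1" using assms by (simp_all add: e_def G_def)
  have denom: "rho_star_denom \<alpha> \<epsilon> \<gamma> M K = m - (G - 1) / (1 - G * e) * c"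
    by (simp add: rho_star_denom_def c_def m_def e_def G_def)
  show ?thesis
  proof (cases "\<rho> = 0")
    case True
    \<comment> \<open>At zero power the rate is 0 by convention and the linear equation reads
      \<open>0 = t * b\<close>; with \<open>b > 0\<close> both sides say
      \<open>G = 1\<close>.\<close>
    have "G = 1 \<longleftrightarrow> \<gamma> = 0" by (simp add: G_def)
    then show ?thesis using True b Ge
      by (auto simp: SE_def simp flip: b_def e_def G_def)
  next
    case False
    then have \<rho>: "\<rho> > 0" using assms by simp
    \<comment> \<open>The denominator inside the logarithm. The noise term \<open>b / \<rho>\<close>
      alone already makes it positive, so multiplying by it is reversible.\<close>
    define X where "X = c + e * m + b / \<rho>"
    have X: "X > 0" unfolding X_def using b c m e \<rho>
      by (intro add_nonneg_pos add_nonneg_nonneg mult_nonneg_nonneg divide_pos_pos) auto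
    have "0 < 1 + (1 - e) * m / X" using X e m by (simp add: add_pos_nonneg)
    then have "log 2 (1 + (1 - e) * m / X) = \<gamma> \<longleftrightarrow> 1 + (1 - e) * m / X = G"
      unfolding G_def by auto
    moreover have "SE \<alpha> \<omega> \<sigma> \<epsilon> \<rho> lam M K = log 2 (1 + (1 - e) * m / X)"
      using False by (simp add: SE_def X_def b_def c_def m_def e_def)
    ultimately have "SE \<alpha> \<omega> \<sigma> \<epsilon> \<rho> lam M K = \<gamma> \<longleftrightarrow> 1 + (1 - e) * m / X = G"
      by simp
    also have "\<dots> \<longleftrightarrow> (1 - e) * m = (G - 1) * X"
      using X by (auto simp: field_simps)
    \<comment> \<open>Multiplying by \<open>\<rho> > 0\<close> removes the term
      \<open>b / \<rho>\<close> hidden in \<open>X\<close>.\<close>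
    also have "\<dots> \<longleftrightarrow> (1 - e) * m * \<rho> = (G - 1) * (X * \<rho>)"
      using \<rho> by simp
    also have "X * \<rho> = (c + e * m) * \<rho> + b"
      using \<rho> by (simp add: X_def field_simps)
    \<comment> \<open>Collecting the multiples of \<open>m * \<rho>\<close> gives the coefficient
      \<open>(1 - e) - (G - 1) * e = 1 - G * e\<close>; dividing by this positive number yields the
      claim.\<close>
    also have "(1 - e) * m * \<rho> = (G - 1) * ((c + e * m) * \<rho> + b) \<longleftrightarrow>
        \<rho> * (m - (G - 1) / (1 - G * e) * c) = (G - 1) / (1 - G * e) * b"
      using Ge by (simp add: field_simps)
    finally show ?thesis by (simp add: denom b_def e_def G_def)
  qed
qed

theorem theorem2:
  fixes \<alpha> \<omega> \<sigma> \<epsilon> \<eta> A C0 C1 D0 D1 lam_max \<gamma> lam :: real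
    and M K :: nat
  assumes "\<alpha> > 2" and "\<omega> > 0" and "\<sigma>\<^sup>2 > 0"
    and "0 \<le> \<epsilon>" and "\<epsilon> < 1"
    and "0 < \<eta>" and "\<eta> \<le> 1"
    and "A > 0" and "C0 > 0" and "C1 > 0" and "D0 > 0" and "D1 > 0"
    and "lam_max > 0"
    and "0 \<le> \<gamma>" and "\<epsilon> > 0 \<Longrightarrow> \<gamma> < - 2 * log 2 \<epsilon>"
    and "0 < lam" and "lam \<le> lam_max"
    and "M > 0" and "K > 0" and "M \<ge> K + 1"
  defines "P \<equiv> EE_problem \<alpha> \<omega> \<sigma> \<epsilon> \<eta> A C0 C1 D0 D1 lam_max \<gamma>"
    and "\<rho>s \<equiv> rho_star \<alpha> \<omega> \<sigma> \<epsilon> \<gamma> lam M K"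
  shows "(feasible_at P lam M K \<longrightarrow> \<rho>s \<ge> 0 \<and> SE \<alpha> \<omega> \<sigma> \<epsilon> \<rho>s lam M K = \<gamma>)
    \<and> (\<rho>s < 0 \<longleftrightarrow> rho_star_denom \<alpha> \<epsilon> \<gamma> M K < 0)
    \<and> (\<rho>s < 0 \<longrightarrow> \<not> feasible_at P lam M K)"
proof -
  define D where "D = rho_star_denom \<alpha> \<epsilon> \<gamma> M K"
  define b where "b = noise_coeff \<alpha> \<omega> \<sigma> lam"
  define t where "t = (2 powr \<gamma> - 1) / (1 - 2 powr \<gamma> * \<epsilon>\<^sup>2)"
  have b: "b > 0" unfolding b_def using assms by (intro noise_coeff_pos)
  have e: "\<epsilon>\<^sup>2 < 1" using assms by (simp add: power_less_one_iff)
  have Ge: "2 powr \<gamma> * \<epsilon>\<^sup>2 < 1" using assms by (intro powr_mult_square_less_1)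
  have t: "t \<ge> 0" unfolding t_def using Ge \<open>0 \<le> \<gamma>\<close> by (simp add: ge_one_powr_ge_zero)
  have D_pos: "D > 0" if "t = 0"
    using that \<open>M \<ge> K + 1\<close> by (simp add: D_def rho_star_denom_def flip: t_def)
  have \<rho>s: "\<rho>s = t * b / D" by (simp add: \<rho>s_def rho_star_eq t_def b_def D_def)
  have SE_iff: "SE \<alpha> \<omega> \<sigma> \<epsilon> \<rho> lam M K = \<gamma> \<longleftrightarrow> \<rho> * D = t * b" if "\<rho> \<ge> 0" for \<rho>
    unfolding D_def t_def b_def using assms that e Ge by (intro SE_eq_iff) auto
  have feasible: "\<rho>s \<ge> 0 \<and> SE \<alpha> \<omega> \<sigma> \<epsilon> \<rho>s lam M K = \<gamma>" if feas: "feasible_at P lam M K"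
  proof -
    obtain \<rho> where \<rho>: "\<rho> \<ge> 0" "SE \<alpha> \<omega> \<sigma> \<epsilon> \<rho> lam M K = \<gamma>"
      using feas by (auto simp: feasible_at_def P_def EE_problem_def)
    then have eq: "\<rho> * D = t * b" using SE_iff by simp
    have "D > 0"
    proof (rule ccontr)
      assume "\<not> D > 0"
      \<comment> \<open>A nonpositive \<open>D\<close> makes the left side of \<open>eq\<close>
        nonpositive, while its right side is nonnegative, so only the degenerate case
        \<open>t = 0\<close> remains.\<close>
      then have "t * b \<le> 0" using \<rho>(1) by (simp add: mult_nonneg_nonpos flip: eq)
      with t b have "t = 0" by (simp add: mult_le_0_iff)
      with D_pos \<open>\<not> D > 0\<close> show False by simp
    qed
    \<comment> \<open>Since \<open>D\<close> is nonzero, the linear equation has a single root, so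
      the given feasible power is \<open>\<rho>s\<close> itself.\<close>
    then have "\<rho>s = \<rho>" by (simp add: \<rho>s flip: eq)
    with \<rho> show ?thesis by simp
  qed
  \<comment> \<open>If \<open>t > 0\<close>, the numerator \<open>t * b\<close> is positive and
    \<open>D\<close> decides the sign; at \<open>D = 0\<close> division by zero gives
    \<open>\<rho>s = 0\<close>, so both sides fail. If \<open>t = 0\<close>, then
    \<open>\<rho>s = 0\<close> and \<open>D > 0\<close>.\<close>
  have sign: "\<rho>s < 0 \<longleftrightarrow> D < 0"
    using t b D_pos by (cases "t = 0") (auto simp: \<rho>s divide_less_0_iff mult_less_0_iff)
  \<comment> \<open>Infeasibility for negative \<open>\<rho>s\<close> is the contrapositive of the
    bound \<open>\<rho>s \<ge> 0\<close> in \<open>feasible\<close>.\<close>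
  show ?thesis using feasible sign by (auto simp: D_def)
qed

end
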